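(* Let $d,n$ be positive integers. The space $\mathcal{C}(\mathbb{R}^d,\le n)$ of all proper or non-proper convex $n$-partitions of $\mathbb{R}^d$, with the topology induced by the metric $d_\mu$, is compact.
   Context: A proper convex $n$-partition of $\mathbb{R}^d$ is an ordered list $\mathcal{P}=(P_1,\dots,P_n)$ of non-empty open convex subsets of $\mathbb{R}^d$ that are pairwise disjoint and satisfy $\bigcup_{i=1}^n\overline{P_i}=\mathbb{R}^d$. A non-proper $n$-partition is defined in the same way except that the $P_i$ are allowed to be empty and at least one of them is empty. $\mathcal{C}(\mathbb{R}^d,\le n)$ is the set of all proper or non-proper $n$-partitions. For $\mathbf{x}\in\mathbb{R}^d$ put $\widehat{\mathbf{x}}=\frac{1}{\sqrt{1+\|\mathbf{x}\|^2}}\binom{1}{\mathbf{x}}\in S^d\subset\mathbb{R}^{d+1}$; this is a bijection from $\mathbb{R}^d$ onto the open upper hemisphere $S^d_+=\{\mathbf{v}\in S^d: v_0>0\}$. For measurable $P\subseteq\mathbb{R}^d$ let $\widehat P=\{\widehat{\mathbf{x}}:\mathbf{x}\in P\}$ and $\mu(P)=\mathrm{vol}_d(\widehat P)$, the standard $d$-dimensional volume on the sphere. The metric is $d_\mu(\mathcal{P},\mathcal{P}')=\sum_{i=1}^n\mu(P_i\,\triangle\, P_i')$, where $\triangle$ denotes symmetric difference. *)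

theory Defs
  imports "HOL-Analysis.Analysis"
begin

section \<open>Convex partitions\<close>

definition proper_partition :: "nat \<Rightarrow> 'a::euclidean_space set list \<Rightarrow> bool" where
  "proper_partition n P \<longleftrightarrow>
     length P = n \<and>
     (\<forall>i<n. P ! i \<noteq> {} \<and> open (P ! i) \<and> convex (P ! i)) \<and>
     (\<forall>i<n. \<forall>j<n. i \<noteq> j \<longrightarrow> P ! i \<inter> P ! j = {}) \<and>
     (\<Union>i<n. closure (P ! i)) = UNIV"

definition nonproper_partition :: "nat \<Rightarrow> 'a::euclidean_space set list \<Rightarrow> bool" where
  "nonproper_partition n P \<longleftrightarrow>
     length P = n \<and>
     (\<forall>i<n. open (P ! i) \<and> convex (P ! i)) \<and>
     (\<exists>i<n. P ! i = {}) \<and>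
     (\<forall>i<n. \<forall>j<n. i \<noteq> j \<longrightarrow> P ! i \<inter> P ! j = {}) \<and>
     (\<Union>i<n. closure (P ! i)) = UNIV"

definition partitions_le :: "nat \<Rightarrow> 'a::euclidean_space set list set" where
  "partitions_le n = {P. proper_partition n P \<or> nonproper_partition n P}"

section \<open>The metric\<close>

text \<open>The space \<open>\<real>\<^sup>d\<^sup>+\<^sup>1\<close> is represented as \<open>real \<times> 'a\<close> with \<open>'a\<close> of dimension \<open>d\<close>; the
  product norm is the Euclidean one, and \<open>fst\<close> is the coordinate \<open>v\<^sub>0\<close>.\<close>

definition hat :: "'a::euclidean_space \<Rightarrow> real \<times> 'a" where
  "hat x = (1 / sqrt (1 + (norm x)\<^sup>2)) *\<^sub>R (1, x)"

text \<open>Standard surface volume on the unit sphere of \<open>'v\<close>, as it occurs in integration in polar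
  coordinates: \<open>A\<close> gets \<open>DIM('v)\<close> times the Lebesgue measure of the cone over \<open>A\<close>
  (the factor is \<open>1 / (\<integral> r\<^sup>D\<^sup>-\<^sup>1 dr)\<close> over \<open>0 < r \<le> 1\<close>, with \<open>D = DIM('v)\<close>).\<close>

definition sphere_cone :: "'v::euclidean_space set \<Rightarrow> 'v set" where
  "sphere_cone A = {r *\<^sub>R v |r v. 0 < r \<and> r \<le> 1 \<and> v \<in> A}"

definition sphere_vol :: "'v::euclidean_space set \<Rightarrow> real" where
  "sphere_vol A = real DIM('v) * measure lebesgue (sphere_cone A)"

definition mu :: "'a::euclidean_space set \<Rightarrow> real" where
  "mu P = sphere_vol (hat ` P)"

definition d_mu :: "nat \<Rightarrow> 'a::euclidean_space set list \<Rightarrow> 'a set list \<Rightarrow> real" where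
  "d_mu n P Q = (\<Sum>i<n. mu (sym_diff (P ! i) (Q ! i)))"

section \<open>\<open>d_mu\<close> is a metric\<close>

lemma norm_hat: "norm (hat x) = 1"
proof -
  have "0 < 1 + (norm x)\<^sup>2" by (simp add: add_pos_nonneg)
  then show ?thesis
    by (simp add: hat_def norm_Pair power_divide flip: add_divide_distrib)
qed

lemma norm_slope:
  fixes z :: "real \<times> 'a::euclidean_space"
  assumes "0 < fst z"
  shows "norm z *\<^sub>R hat (snd z /\<^sub>R fst z) = z"
proof -
  let ?x = "snd z /\<^sub>R fst z" and ?s = "sqrt (1 + (norm (snd z /\<^sub>R fst z))\<^sup>2)"
  have z: "z = fst z *\<^sub>R (1, ?x)" using assms by (simp add: prod_eq_iff)
  have "norm z = norm (fst z *\<^sub>R (1::real, ?x))" using z by (rule arg_cong)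
  also have "\<dots> = fst z * ?s" using assms by (simp add: norm_Pair del: scaleR_Pair)
  finally have n: "norm z = fst z * ?s" .
  have "0 < ?s" by (simp add: add_pos_nonneg)
  then have "norm z *\<^sub>R hat ?x = fst z *\<^sub>R (1, ?x)" unfolding n hat_def by simp
  then show ?thesis using z by simp
qed

lemma sphere_cone_hat:
  "sphere_cone (hat ` P) = {z. 0 < fst z \<and> norm z \<le> 1 \<and> snd z /\<^sub>R fst z \<in> P}"
proof (intro set_eqI iffI)
  fix z assume "z \<in> sphere_cone (hat ` P)"
  then obtain r x where r: "0 < r" "r \<le> 1" "x \<in> P" "z = r *\<^sub>R hat x"
    unfolding sphere_cone_def by blast
  have s: "0 < sqrt (1 + (norm x)\<^sup>2)" by (simp add: add_pos_nonneg)
  have "norm z = r" using r by (simp add: norm_hat)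
  moreover have f: "fst z = r / sqrt (1 + (norm x)\<^sup>2)" "snd z = fst z *\<^sub>R x"
    using r(4) by (auto simp: hat_def)
  moreover have "0 < fst z" unfolding f(1) using r s by simp
  moreover from this have "snd z /\<^sub>R fst z = x" unfolding f(2) by simp
  ultimately show "z \<in> {z. 0 < fst z \<and> norm z \<le> 1 \<and> snd z /\<^sub>R fst z \<in> P}"
    using r(1-3) by simp
next
  fix z :: "real \<times> 'a"
  assume z: "z \<in> {z. 0 < fst z \<and> norm z \<le> 1 \<and> snd z /\<^sub>R fst z \<in> P}"
  then have "0 < norm z" by auto
  with z norm_slope[of z] show "z \<in> sphere_cone (hat ` P)"
    unfolding sphere_cone_def by (smt (verit) imageI mem_Collect_eq)
qed

lemma lmeasurable_cone:
  fixes P :: "'a::euclidean_space set"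
  assumes "P \<in> sets borel"
  shows "sphere_cone (hat ` P) \<in> lmeasurable"
proof -
  have [measurable]: "P \<in> sets borel" by fact
  have "(\<lambda>z::real \<times> 'a. snd z /\<^sub>R fst z) \<in> borel_measurable borel"
    unfolding borel_prod[symmetric] by measurable
  then have m: "(\<lambda>z::real \<times> 'a. snd z /\<^sub>R fst z) -` P \<in> sets borel"
    using measurable_sets_borel[OF _ assms] by blast
  have "open {z::real \<times> 'a. 0 < fst z}"
    by (intro open_Collect_less continuous_intros)
  then have "{z::real \<times> 'a. 0 < fst z} \<inter> cball 0 1 \<inter> (\<lambda>z. snd z /\<^sub>R fst z) -` P \<in> sets borel"
    using m by (intro sets.Int) auto
  moreover have "sphere_cone (hat ` P) =
      {z. 0 < fst z} \<inter> cball 0 1 \<inter> (\<lambda>z. snd z /\<^sub>R fst z) -` P"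
    by (auto simp: sphere_cone_hat)
  ultimately have "sphere_cone (hat ` P) \<in> sets lebesgue" by (simp add: sets_completionI_sets)
  moreover have "bounded (sphere_cone (hat ` P))"
    by (rule bounded_subset[OF bounded_cball[of 0 1]]) (auto simp: sphere_cone_hat)
  ultimately show ?thesis by (rule bounded_set_imp_lmeasurable[rotated])
qed

lemma mu_nonneg: "0 \<le> mu P"
  by (simp add: mu_def sphere_vol_def)

lemma mu_mono:
  assumes "P \<in> sets borel" "Q \<in> sets borel" "P \<subseteq> Q"
  shows "mu P \<le> mu Q"
proof -
  have "sphere_cone (hat ` P) \<subseteq> sphere_cone (hat ` Q)"
    using assms by (auto simp: sphere_cone_hat)
  then have "measure lebesgue (sphere_cone (hat ` P)) \<le> measure lebesgue (sphere_cone (hat ` Q))"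
    using assms by (simp add: measure_mono_fmeasurable lmeasurable_cone fmeasurableD)
  then show ?thesis unfolding mu_def sphere_vol_def by (intro mult_left_mono) auto
qed

lemma mu_Un_le:
  assumes "P \<in> sets borel" "Q \<in> sets borel"
  shows "mu (P \<union> Q) \<le> mu P + mu Q"
proof -
  have "sphere_cone (hat ` (P \<union> Q)) = sphere_cone (hat ` P) \<union> sphere_cone (hat ` Q)"
    by (auto simp: sphere_cone_hat)
  then have "measure lebesgue (sphere_cone (hat ` (P \<union> Q)))
      \<le> measure lebesgue (sphere_cone (hat ` P)) + measure lebesgue (sphere_cone (hat ` Q))"
    using assms by (simp add: measure_Un_le lmeasurable_cone fmeasurableD)
  then show ?thesis
    unfolding mu_def sphere_vol_def distrib_left[symmetric] by (intro mult_left_mono) auto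
qed

lemma mu_open_zero:
  fixes U :: "'a::euclidean_space set"
  assumes "open U" "mu U = 0"
  shows "U = {}"
proof (rule ccontr)
  assume "U \<noteq> {}"
  then obtain x where x: "x \<in> U" by auto
  let ?H = "{z::real \<times> 'a. 0 < fst z}"
  let ?V = "(?H \<inter> (\<lambda>z. snd z /\<^sub>R fst z) -` U) \<inter> ball 0 1"
  have "open ?H" by (intro open_Collect_less continuous_intros)
  moreover have "continuous_on ?H (\<lambda>z. snd z /\<^sub>R fst z)"
    by (intro continuous_intros) auto
  ultimately have "open ?V"
    using assms(1) by (intro open_Int continuous_open_preimage) auto
  moreover have "(1/2) *\<^sub>R hat x \<in> ?V"
  proof -
    have "0 < sqrt (1 + (norm x)\<^sup>2)" by (simp add: add_pos_nonneg)
    then have "0 < fst (hat x)" "snd (hat x) = fst (hat x) *\<^sub>R x" by (simp_all add: hat_def)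
    then show ?thesis using x by (simp add: norm_hat)
  qed
  ultimately have "\<not> negligible ?V" by (metis empty_iff open_not_negligible)
  moreover have "?V \<subseteq> sphere_cone (hat ` U)" by (auto simp: sphere_cone_hat)
  moreover have "negligible (sphere_cone (hat ` U))"
    using assms by (simp add: negligible_iff_measure0 lmeasurable_cone mu_def sphere_vol_def)
  ultimately show False using negligible_subset by blast
qed

lemma mu_diff_zero_subset:
  fixes P Q :: "'a::euclidean_space set"
  assumes "open P" "open Q" "convex Q" "mu (sym_diff P Q) = 0"
  shows "P \<subseteq> Q"
proof -
  have "mu (P - closure Q) \<le> mu (sym_diff P Q)"
    using assms closure_subset[of Q] by (intro mu_mono) (auto intro!: sets.Un sets.Diff)
  then have "mu (P - closure Q) = 0" using assms(4) mu_nonneg[of "P - closure Q"] by simp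
  then have "P - closure Q = {}" using assms by (intro mu_open_zero) auto
  then have "P \<subseteq> interior (closure Q)" using assms(1) by (intro interior_maximal) auto
  then show ?thesis using assms by (simp add: convex_interior_closure interior_open)
qed

lemma Metric_space_partitions:
  "Metric_space (partitions_le n :: 'a::euclidean_space set list set) (d_mu n)"
proof
  fix P Q R :: "'a set list"
  show "0 \<le> d_mu n P Q" unfolding d_mu_def by (intro sum_nonneg mu_nonneg)
  show "d_mu n P Q = d_mu n Q P" unfolding d_mu_def by (simp add: Un_commute)
  have oc: "length S = n" "i < n \<Longrightarrow> open (S ! i)" "i < n \<Longrightarrow> convex (S ! i)"
    if "S \<in> partitions_le n" for S :: "'a set list" and i
    using that by (auto simp: partitions_le_def proper_partition_def nonproper_partition_def)
  show "d_mu n P Q = 0 \<longleftrightarrow> P = Q" if P: "P \<in> partitions_le n" and Q: "Q \<in> partitions_le n"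
  proof
    assume 0: "d_mu n P Q = 0"
    have eq: "mu (sym_diff (P ! i) (Q ! i)) = 0" if "i < n" for i
      using 0 that unfolding d_mu_def by (subst (asm) sum_nonneg_eq_0_iff) (auto simp: mu_nonneg)
    have "P ! i = Q ! i" if "i < n" for i
      using eq[OF that] oc[OF P] oc[OF Q] that
        mu_diff_zero_subset[of "P ! i" "Q ! i"] mu_diff_zero_subset[of "Q ! i" "P ! i"]
      by (auto simp: Un_commute)
    then show "P = Q" using oc[OF P] oc[OF Q] by (simp add: list_eq_iff_nth_eq)
  next
    assume "P = Q"
    then show "d_mu n P Q = 0"
      by (simp add: d_mu_def mu_def sphere_vol_def sphere_cone_def)
  qed
  show "d_mu n P R \<le> d_mu n P Q + d_mu n Q R"
    if "P \<in> partitions_le n" "Q \<in> partitions_le n" "R \<in> partitions_le n"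
  proof -
    have "mu (sym_diff (P ! i) (R ! i))
        \<le> mu (sym_diff (P ! i) (Q ! i)) + mu (sym_diff (Q ! i) (R ! i))" if "i < n" for i
    proof -
      have b: "sym_diff (S ! i) (T ! i) \<in> sets borel"
        if "S \<in> {P, Q, R}" "T \<in> {P, Q, R}" for S T
        using oc \<open>i < n\<close> \<open>P \<in> _\<close> \<open>Q \<in> _\<close> \<open>R \<in> _\<close> that
        by (intro sets.Un sets.Diff) auto
      have "mu (sym_diff (P ! i) (R ! i))
          \<le> mu (sym_diff (P ! i) (Q ! i) \<union> sym_diff (Q ! i) (R ! i))"
        by (intro mu_mono sets.Un[OF b b] b) auto
      also have "\<dots> \<le> mu (sym_diff (P ! i) (Q ! i)) + mu (sym_diff (Q ! i) (R ! i))"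
        by (intro mu_Un_le b) auto
      finally show ?thesis .
    qed
    then show ?thesis unfolding d_mu_def sum.distrib[symmetric] by (intro sum_mono) auto
  qed
qed

end

theory Submission
  imports Defs "HOL-Complex_Analysis.Great_Picard"
begin

text \<open>Given a sequence of partitions, choose a countable dense set \<open>D\<close> avoiding the (negligible)
  boundaries of all cells of all partitions, so that every point of \<open>D\<close> lies in exactly one cell of
  each partition. Pass to a subsequence along which the cell containing \<open>q\<close> is eventually constant,
  for every \<open>q \<in> D\<close>. The limit cell \<open>Q i\<close> is the interior of the convex hull of the points of \<open>D\<close>
  that eventually lie in cell \<open>i\<close>: by convexity every point of \<open>Q i\<close> eventually lies in cell \<open>i\<close>.
  The closures of the limit cells cover the space, because those hulls that have empty interior are
  negligible and hence cannot cover a ball. Almost every point then eventually lies in the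
  right cell, and convergence in \<open>d_mu\<close> follows by dominated convergence.\<close>

text \<open>The two kinds of partition differ only in whether some cell is empty, so in their union
  no condition on emptiness remains.\<close>

lemma partitions_le_iff:
  "P \<in> partitions_le n \<longleftrightarrow>
     length P = n \<and> (\<forall>i<n. open (P ! i) \<and> convex (P ! i)) \<and>
     (\<forall>i<n. \<forall>j<n. i \<noteq> j \<longrightarrow> P ! i \<inter> P ! j = {}) \<and> (\<Union>i<n. closure (P ! i)) = UNIV"
  unfolding partitions_le_def proper_partition_def nonproper_partition_def by blast

lemma partitions_le_cell:
  assumes "P \<in> partitions_le n" and "x \<notin> (\<Union>i<n. frontier (P ! i))"
  obtains i where "i < n" "x \<in> P ! i"
proof -
  have "x \<in> (\<Union>i<n. closure (P ! i))"
    using assms(1) by (simp add: partitions_le_iff)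
  then obtain i where "i < n" "x \<in> closure (P ! i)" by blast
  moreover from this have "x \<in> P ! i"
    using assms interior_subset[of "P ! i"] by (auto simp: frontier_def)
  ultimately show thesis using that by blast
qed

text \<open>Frontiers of convex sets are null, and coning turns the frontier of \<open>C\<close>
  into a part of the frontier of a convex cone one dimension higher.\<close>

lemma negligible_cone_frontier:
  fixes C :: "'a::euclidean_space set"
  assumes "open C" "convex C"
  shows "negligible (sphere_cone (hat ` frontier C))"
proof -
  \<comment> \<open>\<open>K\<close> is the unbounded open cone over \<open>{1}\<close> \<times>
    \<open>C\<close>.\<close>
  define K where "K = {z::real \<times> 'a. 0 < fst z \<and> snd z /\<^sub>R fst z \<in> C}"
  have "convex K"
    unfolding convex_def
  proof (intro ballI allI impI)
    fix z w :: "real \<times> 'a" and u v :: real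
    assume z: "z \<in> K" and w: "w \<in> K" and uv: "0 \<le> u" "0 \<le> v" "u + v = 1"
    let ?s = "u * fst z + v * fst w"
    have pos: "0 < fst z" "0 < fst w" using z w by (auto simp: K_def)
    have s: "0 < ?s"
      using pos uv by (cases "u = 0") (auto intro: add_pos_nonneg)
    have cancel: "(p * a / ?s) *\<^sub>R (y /\<^sub>R a) = (p / ?s) *\<^sub>R y"
      if "0 < a" for p a :: real and y :: 'a
    proof -
      have "p * a / ?s * inverse a = p / ?s" using that by simp
      then show ?thesis by (simp only: scaleR_scaleR)
    qed
    \<comment> \<open>The slope of \<open>u *\<^sub>R z + v *\<^sub>R w\<close> is a convex
      combination of the slopes of \<open>z\<close> and \<open>w\<close>, with weights proportional
      to \<open>u * fst z\<close> and \<open>v * fst w\<close>.\<close>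
    have "(u * fst z / ?s) *\<^sub>R (snd z /\<^sub>R fst z) + (v * fst w / ?s) *\<^sub>R (snd w /\<^sub>R fst w) \<in> C"
      using assms(2) z w pos uv s
      by (intro convexD) (auto simp: K_def simp flip: add_divide_distrib)
    moreover have "(u * fst z / ?s) *\<^sub>R (snd z /\<^sub>R fst z) + (v * fst w / ?s) *\<^sub>R (snd w /\<^sub>R fst w)
        = (u *\<^sub>R snd z + v *\<^sub>R snd w) /\<^sub>R ?s"
      by (simp only: cancel pos) (simp add: scaleR_add_right divide_inverse mult.commute)
    ultimately show "u *\<^sub>R z + v *\<^sub>R w \<in> K" using s by (simp add: K_def)
  qed
  then have "negligible (frontier K)" by (rule negligible_convex_frontier)
  moreover have "sphere_cone (hat ` frontier C) \<subseteq> frontier K"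
  proof
    fix z assume "z \<in> sphere_cone (hat ` frontier C)"
    then have z: "0 < fst z" "snd z /\<^sub>R fst z \<in> frontier C" by (auto simp: sphere_cone_hat)
    then have nin: "snd z /\<^sub>R fst z \<notin> C" and cl: "snd z /\<^sub>R fst z \<in> closure C"
      using assms(1) by (auto simp: frontier_def interior_open)
    from cl obtain c where c: "\<And>k. c k \<in> C" "c \<longlonglongrightarrow> snd z /\<^sub>R fst z"
      unfolding closure_sequential by blast
    \<comment> \<open>Points of \<open>K\<close> at the same height as \<open>z\<close> approach it
      when their slopes approach the slope of \<open>z\<close>.\<close>
    have "(\<lambda>k. (fst z, fst z *\<^sub>R c k)) \<longlonglongrightarrow> (fst z, fst z *\<^sub>R (snd z /\<^sub>R fst z))"
      by (intro tendsto_intros c)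
    then have "(\<lambda>k. (fst z, fst z *\<^sub>R c k)) \<longlonglongrightarrow> z" using z by simp
    moreover have "(fst z, fst z *\<^sub>R c k) \<in> K" for k
      using z c by (simp add: K_def)
    ultimately have "z \<in> closure K"
      unfolding closure_sequential by (intro exI[of _ "\<lambda>k. (fst z, fst z *\<^sub>R c k)"]) auto
    moreover have "z \<notin> interior K" using nin interior_subset by (auto simp: K_def)
    ultimately show "z \<in> frontier K" by (simp add: frontier_def)
  qed
  ultimately show ?thesis using negligible_subset by blast
qed

text \<open>Dominated convergence for the indicators of the cones. All cones lie in the upper half
  of the unit ball, which has finite measure, and null sets are measured by their cones as
  well.\<close>

lemma mu_tendsto_0:
  fixes A :: "nat \<Rightarrow> 'a::euclidean_space set"
  assumes A: "\<And>k. A k \<in> sets borel"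
    and N: "negligible (sphere_cone (hat ` N))"
    and ev: "\<And>x. x \<notin> N \<Longrightarrow> \<forall>\<^sub>F k in sequentially. x \<notin> A k"
  shows "(\<lambda>k. mu (A k)) \<longlonglongrightarrow> 0"
proof -
  define S where "S k = sphere_cone (hat ` A k)" for k
  define U where "U = sphere_cone (hat ` (UNIV :: 'a set))"
  have S: "S k \<in> lmeasurable" for k unfolding S_def by (rule lmeasurable_cone[OF A])
  have U: "U \<in> lmeasurable" unfolding U_def by (rule lmeasurable_cone) simp
  have "AE z in lebesgue. z \<notin> sphere_cone (hat ` N)"
    using N by (intro AE_not_in) (simp add: negligible_iff_null_sets)
  then have lim: "AE z in lebesgue. (\<lambda>k. indicat_real (S k) z) \<longlonglongrightarrow> 0"
  proof eventually_elim
    case (elim z)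
    have "\<forall>\<^sub>F k in sequentially. indicat_real (S k) z = 0"
    proof (cases "0 < fst z \<and> norm z \<le> 1")
      case True
      with elim have "snd z /\<^sub>R fst z \<notin> N" by (simp add: sphere_cone_hat)
      from ev[OF this] show ?thesis
        by eventually_elim (simp add: S_def sphere_cone_hat)
    next
      case False
      then have "z \<notin> S k" for k by (auto simp: S_def sphere_cone_hat)
      then show ?thesis by simp
    qed
    then show ?case by (rule tendsto_eventually)
  qed
  have "(\<lambda>k. integral\<^sup>L lebesgue (indicat_real (S k))) \<longlonglongrightarrow> integral\<^sup>L lebesgue (\<lambda>_ :: real \<times> 'a. 0 :: real)"
  proof (rule integral_dominated_convergence[where w = "indicat_real U"])
    show "integrable lebesgue (indicat_real U)"
      using U by (intro integrable_real_indicator) (simp_all add: fmeasurable_def del: emeasure_completion)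
    show "indicat_real (S k) \<in> borel_measurable lebesgue" for k
      using S by (simp add: fmeasurableD)
    show "AE z in lebesgue. norm (indicat_real (S k) z) \<le> indicat_real U z" for k
      by (auto simp: S_def U_def sphere_cone_hat indicator_def)
  qed (use lim in auto)
  then have "(\<lambda>k. measure lebesgue (S k)) \<longlonglongrightarrow> 0"
    using S by simp
  then have "(\<lambda>k. real DIM(real \<times> 'a) * measure lebesgue (S k)) \<longlonglongrightarrow> 0"
    by (rule tendsto_mult_right_zero)
  then show ?thesis by (simp add: mu_def sphere_vol_def S_def)
qed

text \<open>The points that are eventually in \<open>C k\<close> form a convex set: for two such
  points, both memberships eventually hold together.\<close>

lemma eventually_mem_convex_hull:
  assumes "\<And>k. convex (C k)" and "\<And>q. q \<in> A \<Longrightarrow> \<forall>\<^sub>F k in F. q \<in> C k"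
    and "x \<in> convex hull A"
  shows "\<forall>\<^sub>F k in F. x \<in> C k"
proof -
  have "convex {x. \<forall>\<^sub>F k in F. x \<in> C k}"
    unfolding convex_def
  proof (intro ballI allI impI, simp)
    fix x y and u v :: real
    assume x: "\<forall>\<^sub>F k in F. x \<in> C k" and y: "\<forall>\<^sub>F k in F. y \<in> C k"
      and uv: "0 \<le> u" "0 \<le> v" "u + v = 1"
    from x y show "\<forall>\<^sub>F k in F. u *\<^sub>R x + v *\<^sub>R y \<in> C k"
      by eventually_elim (use assms(1) uv in \<open>auto intro: convexD\<close>)
  qed
  then have "convex hull A \<subseteq> {x. \<forall>\<^sub>F k in F. x \<in> C k}"
    using assms(2) by (intro hull_minimal) auto
  then show ?thesis using assms(3) by blast
qed

lemma partitions_le_stable_dense_set: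
  fixes \<sigma> :: "nat \<Rightarrow> 'a::euclidean_space set list"
  assumes "range \<sigma> \<subseteq> partitions_le n"
  obtains D and r :: "nat \<Rightarrow> nat" where "closure D = UNIV" "strict_mono r"
    "\<And>q. q \<in> D \<Longrightarrow> \<exists>i<n. \<forall>\<^sub>F k in sequentially. q \<in> \<sigma> (r k) ! i"
proof -
  have \<sigma>: "\<sigma> k \<in> partitions_le n" for k using assms by blast
  define B where "B = (\<Union>k. \<Union>i<n. frontier (\<sigma> k ! i))"
  have "negligible (\<Union>i<n. frontier (\<sigma> k ! i))" for k
    using \<sigma>[of k] by (intro negligible_Union) (auto simp: partitions_le_iff intro!: negligible_convex_frontier)
  \<comment> \<open>A null set has empty interior, so its complement is dense and contains a
    countable dense set.\<close>
  then have "negligible B" unfolding B_def by (rule negligible_Union_nat)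
  then have "interior B = {}"
    using open_not_negligible[of "interior B"] negligible_subset[OF _ interior_subset] by auto
  then have dense: "closure (- B) = UNIV" by (simp add: closure_complement)
  obtain D where D: "countable D" "D \<subseteq> - B" "- B \<subseteq> closure D"
    using separable by blast
  have "closure D = UNIV"
    using closure_minimal[OF D(3) closed_closure] dense by auto
  define c where "c k q = (SOME i. i < n \<and> q \<in> \<sigma> k ! i)" for k q
  have c: "c k q < n \<and> q \<in> \<sigma> k ! c k q" if "q \<in> D" for k q
  proof -
    have "q \<notin> (\<Union>i<n. frontier (\<sigma> k ! i))" using that D(2) by (auto simp: B_def)
    from partitions_le_cell[OF \<sigma> this] have "\<exists>i. i < n \<and> q \<in> \<sigma> k ! i" by blast
    then show ?thesis unfolding c_def by (rule someI_ex)
  qed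
  \<comment> \<open>Cell labels are bounded by \<open>n\<close>. Read as real functions on the
    countable set \<open>D\<close>, they have a pointwise convergent subsequence by a diagonal
    argument.\<close>
  have "norm (real (c k q)) \<le> real n" if "q \<in> D" for k q
    using c[OF that, of k] by simp
  then obtain r :: "nat \<Rightarrow> nat" where r: "strict_mono r"
    and lim: "\<And>q. q \<in> D \<Longrightarrow> \<exists>l. (\<lambda>k. real (c (r k) q)) \<longlonglongrightarrow> l"
    using function_convergent_subsequence[OF D(1), of "\<lambda>k q. real (c k q)" "real n"] by metis
  have "\<exists>i<n. \<forall>\<^sub>F k in sequentially. q \<in> \<sigma> (r k) ! i" if q: "q \<in> D" for q
  proof -
    have "Cauchy (\<lambda>k. real (c (r k) q))"
      using lim[OF q] by (auto intro: LIMSEQ_imp_Cauchy)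
    from CauchyD[OF this zero_less_one] obtain M
      \<comment> \<open>Natural numbers at distance less than 1 are equal, so a convergent sequence
        of labels is eventually constant.\<close>
      where M: "\<And>m k. M \<le> m \<Longrightarrow> M \<le> k \<Longrightarrow> norm (real (c (r m) q) - real (c (r k) q)) < 1"
      by auto
    have "c (r k) q = c (r M) q" if "M \<le> k" for k
      using M[of k M] that by simp
    then have "\<forall>k\<ge>M. q \<in> \<sigma> (r k) ! c (r M) q" using c[OF q] by metis
    then show ?thesis using c[OF q] unfolding eventually_sequentially by blast
  qed
  with \<open>closure D = UNIV\<close> r show thesis by (rule that)
qed

lemma UN_closure_interior_convex_hull_eq_UNIV:
  fixes A :: "'i \<Rightarrow> 'a::euclidean_space set"
  assumes "finite I" and dense: "closure (\<Union>i\<in>I. A i) = UNIV"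
  shows "(\<Union>i\<in>I. closure (interior (convex hull A i))) = UNIV"
proof (rule ccontr)
  define W where "W = (\<Union>i\<in>I. closure (interior (convex hull A i)))"
  define J where "J = {i\<in>I. interior (convex hull A i) = {}}"
  assume "(\<Union>i\<in>I. closure (interior (convex hull A i))) \<noteq> UNIV"
  then have "- W \<noteq> {}" by (auto simp: W_def)
  moreover have "closed W" unfolding W_def using assms(1) by (intro closed_UN) auto
  then have "open (- W)" by (rule open_Compl)
  ultimately have "\<not> negligible (- W)" by (rule open_not_negligible[rotated])
  moreover have "- W \<subseteq> (\<Union>i\<in>J. closure (convex hull A i))"
  proof -
    \<comment> \<open>A convex set with non-empty interior has the same closure as its interior, so
      only the thin hulls, indexed by \<open>J\<close>, can meet the complement of
      \<open>W\<close>.\<close>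
    have in_W: "closure (A i) \<subseteq> W" if "i \<in> I - J" for i
    proof -
      have "closure (interior (convex hull A i)) = closure (convex hull A i)"
        using that by (intro convex_closure_interior) (auto simp: J_def)
      then show ?thesis
        using that closure_mono[OF hull_subset[of "A i" convex]] by (auto simp: W_def)
    qed
    have "closure (\<Union>i\<in>I. A i) \<subseteq> (\<Union>i\<in>I. closure (A i))"
      using assms(1) closure_subset by (intro closure_minimal closed_UN) auto
    then have "x \<in> (\<Union>i\<in>I. closure (A i))" for x using dense by auto
    moreover have "closure (A i) \<subseteq> closure (convex hull A i)" for i
      by (intro closure_mono hull_subset)
    ultimately show ?thesis using in_W by blast
  qed
  moreover have "negligible (\<Union>i\<in>J. closure (convex hull A i))"
  proof (intro negligible_Union)
    show "finite ((\<lambda>i. closure (convex hull A i)) ` J)" using assms(1) by (simp add: J_def)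
  qed (auto simp: J_def negligible_convex_interior convex_closure convex_interior_closure)
  ultimately show False using negligible_subset by blast
qed

lemma partitions_le_convergent_subsequence:
  fixes \<sigma> :: "nat \<Rightarrow> 'a::euclidean_space set list"
  assumes "range \<sigma> \<subseteq> partitions_le n"
  obtains Q and r :: "nat \<Rightarrow> nat" where "Q \<in> partitions_le n" "strict_mono r"
    "(\<lambda>k. d_mu n (\<sigma> (r k)) Q) \<longlonglongrightarrow> 0"
proof -
  obtain D and r :: "nat \<Rightarrow> nat" where D: "closure D = UNIV" and r: "strict_mono r"
    and stable: "\<And>q. q \<in> D \<Longrightarrow> \<exists>i<n. \<forall>\<^sub>F k in sequentially. q \<in> \<sigma> (r k) ! i"
    using partitions_le_stable_dense_set[OF assms] by blast
  define P where "P k = \<sigma> (r k)" for k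
  have P: "P k \<in> partitions_le n" for k using assms by (auto simp: P_def)
  have P_cell: "open (P k ! i)" "convex (P k ! i)" if "i < n" for k i
    using P[of k] that by (auto simp: partitions_le_iff)
  have P_disj: "x \<notin> P k ! j" if "x \<in> P k ! i" "i < n" "j < n" "i \<noteq> j" for x k i j
    using P[of k] that by (auto simp: partitions_le_iff)
  define A where "A i = {q \<in> D. \<forall>\<^sub>F k in sequentially. q \<in> P k ! i}" for i
  \<comment> \<open>A hull with empty interior yields an empty cell, so proper partitions may
    converge to a non-proper one.\<close>
  define Q where "Q = map (\<lambda>i. interior (convex hull A i)) [0..<n]"
  have Q_nth: "Q ! i = interior (convex hull A i)" if "i < n" for i
    using that by (simp add: Q_def)
  have Q_cell: "open (Q ! i)" "convex (Q ! i)" if "i < n" for i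
    using that by (simp_all add: Q_nth convex_interior)
  have ev: "\<forall>\<^sub>F k in sequentially. x \<in> P k ! i" if "i < n" "x \<in> Q ! i" for i x
  proof (rule eventually_mem_convex_hull)
    show "x \<in> convex hull A i"
      using that interior_subset[of "convex hull A i"] by (auto simp: Q_nth)
  qed (use that P_cell in \<open>auto simp: A_def\<close>)
  have disj: "Q ! i \<inter> Q ! j = {}" if "i < n" "j < n" "i \<noteq> j" for i j
  proof -
    have False if x: "x \<in> Q ! i" "x \<in> Q ! j" for x
    proof -
      note ij = \<open>i < n\<close> \<open>j < n\<close> \<open>i \<noteq> j\<close>
      \<comment> \<open>A common point of two limit cells would eventually lie in two disjoint cells
        of \<open>P k\<close>.\<close>
      have "\<forall>\<^sub>F k in sequentially. False"
        using ev[OF \<open>i < n\<close> x(1)] ev[OF \<open>j < n\<close> x(2)]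
        by eventually_elim (rule notE[OF P_disj[OF _ ij]])
      then show False by simp
    qed
    then show ?thesis by blast
  qed
  have "D \<subseteq> (\<Union>i<n. A i)" using stable by (auto simp: A_def P_def)
  then have "closure (\<Union>i<n. A i) = UNIV" using D closure_mono[of D "\<Union>i<n. A i"] by auto
  then have "(\<Union>i<n. closure (Q ! i)) = UNIV"
    using UN_closure_interior_convex_hull_eq_UNIV[of "{..<n}" A] by (simp add: Q_nth)
  then have Q: "Q \<in> partitions_le n"
    using Q_cell disj by (simp add: partitions_le_iff Q_def)
  define N where "N = (\<Union>i<n. frontier (Q ! i))"
  have "sphere_cone (hat ` N) = (\<Union>i<n. sphere_cone (hat ` frontier (Q ! i)))"
    by (auto simp: N_def sphere_cone_hat)
  then have N: "negligible (sphere_cone (hat ` N))"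
    using Q_cell by (auto intro!: negligible_Union negligible_cone_frontier)
  have "(\<lambda>k. mu (sym_diff (P k ! i) (Q ! i))) \<longlonglongrightarrow> 0" if i: "i < n" for i
  proof (rule mu_tendsto_0[OF _ N])
    show "sym_diff (P k ! i) (Q ! i) \<in> sets borel" for k
      using P_cell[OF i] Q_cell[OF i] by (intro sets.Un sets.Diff) auto
    fix x assume "x \<notin> N"
    then obtain j where j: "j < n" "x \<in> Q ! j"
      using partitions_le_cell[OF Q] by (auto simp: N_def)
    \<comment> \<open>Once \<open>x\<close> lies in cell \<open>j\<close> of both \<open>P k\<close>
      and \<open>Q\<close>, disjointness decides its membership in cell \<open>i\<close> in the same
      way for both.\<close>
    from ev[OF j] show "\<forall>\<^sub>F k in sequentially. x \<notin> sym_diff (P k ! i) (Q ! i)"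
    proof eventually_elim
      case (elim k)
      then show ?case
        using P_disj[OF elim j(1) i] disj[OF i j(1)] j(2) by (cases "i = j") auto
    qed
  qed
  then have "(\<lambda>k. d_mu n (P k) Q) \<longlonglongrightarrow> 0"
    unfolding d_mu_def by (intro tendsto_null_sum) auto
  with Q r show thesis by (intro that) (auto simp: P_def)
qed

theorem theorem3p3:
  fixes n :: nat
  assumes "n > 0"
  shows "compact_space
    (Metric_space.mtopology (partitions_le n :: (real^'d::finite) set list set) (d_mu n))"
proof -
  interpret Metric_space "partitions_le n :: (real^'d) set list set" "d_mu n"
    by (rule Metric_space_partitions)
  \<comment> \<open>For a metric space, compactness amounts to sequential compactness.\<close>
  show ?thesis
    unfolding compact_space_sequentially
  proof (intro allI impI)
    fix \<sigma> :: "nat \<Rightarrow> (real^'d) set list"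
    assume \<sigma>: "range \<sigma> \<subseteq> partitions_le n"
    then obtain Q and r :: "nat \<Rightarrow> nat" where "Q \<in> partitions_le n" "strict_mono r"
      "(\<lambda>k. d_mu n (\<sigma> (r k)) Q) \<longlonglongrightarrow> 0"
      by (rule partitions_le_convergent_subsequence)
    moreover have "\<forall>\<^sub>F k in sequentially. (\<sigma> \<circ> r) k \<in> partitions_le n"
      using \<sigma> by (intro always_eventually) auto
    ultimately show "\<exists>Q r. Q \<in> partitions_le n \<and> strict_mono r
        \<and> limitin mtopology (\<sigma> \<circ> r) Q sequentially"
      unfolding limitin_metric_dist_null by (auto simp: o_def)
  qed
qed

end
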